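(* Fix integer constants $2 \le d_{\min} \le d_{\max}$. There exist constants $C>0$ and $N$ (depending only on $d_{\min}$ and $d_{\max}$) such that the following holds for every $n \ge N$. Let $V$ be a set of $n$ vertices with an arbitrary partition $(V_1, V_P)$ into player-1 vertices and probabilistic vertices, let $B \subseteq V$ be an arbitrary target (B\"uchi) set, and let each $v \in V$ have a prescribed out-degree $d_v$ with $d_{\min} \le d_v \le d_{\max}$. Let the edge set be random: for each $v$, independently of all other vertices, the out-neighbour set $E(v)$ is chosen uniformly at random among all $d_v$-element subsets of $V$. Then the expected number of iterations of the classical algorithm for almost-sure winning in MDPs with B\"uchi objective $B$ on the resulting MDP is at most $C \log n$, and its expected running time is at most $C n$; i.e., the expected number of iterations is $O(\log n)$ and the expected running time is $O(n)$.
   Context: An MDP graph consists of a finite directed graph $(V,E)$ together with a partition $(V_1,V_P)$ of $V$ into player-1 vertices and probabilistic vertices (the transition probabilities play no role for the algorithm). For $U \subseteq V$ in a graph $G$, the random attractor $\mathrm{Attr}_P(U)$ is $\bigcup_{i\ge 0} X_i$, where $X_0=U$ and $X_{i+1}= X_i \cup \{v\in V_P : E(v)\cap X_i \neq\emptyset\} \cup \{v \in V_1 : E(v)\subseteq X_i\}$. The classical algorithm for MDPs with B\"uchi objective $B$ works in iterations: starting from $G^1=G$ with vertex set $V^1=V$, in iteration $i$ it (i) computes the set $Z^i$ of vertices of $G^i$ that have a directed path in $G^i$ to a vertex of $B\cap V^i$; (ii) sets $U^i = V^i\setminus Z^i$; if $U^i=\emptyset$ it stops and outputs $Z^i$ (the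 almost-sure winning set), otherwise it removes $\mathrm{Attr}_P(U^i)$ (computed in $G^i$) from $G^i$ to obtain $G^{i+1}$ and proceeds to iteration $i+1$. Each iteration is implemented by graph reachability and alternating reachability in time linear in the size of the current graph. *)

theory Defs
  imports "HOL-Probability.Probability"
begin

text \<open>An MDP graph on vertex set {..<n}: E v is the out-neighbour set of v, V1 the
player-1 vertices (the rest are probabilistic). The current graph G^i is the
subgraph induced by the current vertex set W (edges E v \<inter> W for v \<in> W).\<close>

definition edges_in :: "(nat \<Rightarrow> nat set) \<Rightarrow> nat set \<Rightarrow> (nat \<times> nat) set" where
  "edges_in E W = {(u, v). u \<in> W \<and> v \<in> W \<and> v \<in> E u}"

definition reach_set :: "(nat \<Rightarrow> nat set) \<Rightarrow> nat set \<Rightarrow> nat set \<Rightarrow> nat set" where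
  "reach_set E B W = {v \<in> W. \<exists>u \<in> B \<inter> W. (v, u) \<in> (edges_in E W)\<^sup>*}"

definition attr_step :: "(nat \<Rightarrow> nat set) \<Rightarrow> nat set \<Rightarrow> nat set \<Rightarrow> nat set \<Rightarrow> nat set" where
  "attr_step E V1 W X = X \<union> {v \<in> W - V1. E v \<inter> W \<inter> X \<noteq> {}} \<union> {v \<in> W \<inter> V1. E v \<inter> W \<subseteq> X}"

definition attr_P :: "(nat \<Rightarrow> nat set) \<Rightarrow> nat set \<Rightarrow> nat set \<Rightarrow> nat set \<Rightarrow> nat set" where
  "attr_P E V1 W U = (\<Union>i. (attr_step E V1 W ^^ i) U)"

definition unreach :: "(nat \<Rightarrow> nat set) \<Rightarrow> nat set \<Rightarrow> nat set \<Rightarrow> nat set" where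
  "unreach E B W = W - reach_set E B W"

definition alg_step :: "(nat \<Rightarrow> nat set) \<Rightarrow> nat set \<Rightarrow> nat set \<Rightarrow> nat set \<Rightarrow> nat set" where
  "alg_step E V1 B W =
     (if unreach E B W = {} then W else W - attr_P E V1 W (unreach E B W))"

text \<open>V^{k+1} = vertex set of G^{k+1}; V^1 = {..<n}.\<close>
definition alg_vertices :: "nat \<Rightarrow> (nat \<Rightarrow> nat set) \<Rightarrow> nat set \<Rightarrow> nat set \<Rightarrow> nat \<Rightarrow> nat set" where
  "alg_vertices n E V1 B k = (alg_step E V1 B ^^ k) {..<n}"

text \<open>Number of iterations: the index i (starting at 1) of the iteration in which U^i = {}.\<close>
definition num_iterations :: "nat \<Rightarrow> (nat \<Rightarrow> nat set) \<Rightarrow> nat set \<Rightarrow> nat set \<Rightarrow> nat" where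
  "num_iterations n E V1 B =
     Suc (LEAST k. unreach E B (alg_vertices n E V1 B k) = {})"

text \<open>Running time (up to the constant factor of the linear-time iteration):
 the sum over all iterations of the size |V^i| + |E^i| of the current graph.\<close>
definition running_time :: "nat \<Rightarrow> (nat \<Rightarrow> nat set) \<Rightarrow> nat set \<Rightarrow> nat set \<Rightarrow> nat" where
  "running_time n E V1 B =
     (\<Sum>k < num_iterations n E V1 B.
        card (alg_vertices n E V1 B k) + card (edges_in E (alg_vertices n E V1 B k)))"

definition random_edges :: "nat \<Rightarrow> (nat \<Rightarrow> nat) \<Rightarrow> (nat \<Rightarrow> nat set) pmf" where
  "random_edges n d = Pi_pmf {..<n} {} (\<lambda>v. pmf_of_set {S. S \<subseteq> {..<n} \<and> card S = d v})"

end

theory Submission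
  imports Defs
begin

text \<open>
  Let \<open>Z\<close> be the set of vertices that reach \<open>B\<close> in the whole graph, and \<open>T\<close> its size. If \<open>T = n\<close>
  there is one iteration; otherwise every later graph lives inside \<open>Z\<close>, so there are at most
  \<open>T + 2\<close> iterations. Since an iteration costs \<open>O(n)\<close>, both claims follow once the expectation of
  \<open>T + 1\<close> on the event \<open>T < n\<close> is bounded by a constant; the expected number of iterations is
  then even \<open>O(1)\<close>.

  If \<open>Z\<close> is the reaching set, then every vertex outside \<open>Z\<close> has no edge into \<open>Z\<close>, and every vertex
  of \<open>Z - B\<close> has one. These events are independent over the vertices, so summing over all \<open>Z\<close> of
  size \<open>t\<close> bounds the probability of \<open>T = t\<close> by that of a sum of independent Bernoulli variables
  with parameters at least \<open>1 - (1 - t/n)\<^sup>2\<close> being equal to \<open>t - card B\<close>. For \<open>t \<le> 3n/4\<close> the Chernoff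
  method gives a bound that is geometric in \<open>t\<close>. For \<open>t = n - s\<close> with \<open>1 \<le> s < n/4\<close> the union bound over
  the closed set \<open>V - Z\<close> gives \<open>(n choose s) (s/n)\<^bsup>2s\<^esup> \<le> (3s/n)\<^bsup>s\<^esup>\<close>, which sums to \<open>O(1/n)\<close>.
\<close>

section \<open>The algorithm on a fixed graph\<close>

lemma reach_set_subset: "reach_set E B W \<subseteq> W"
  by (auto simp: reach_set_def)

lemma subset_attr_P: "U \<subseteq> attr_P E V1 W U"
proof -
  have "(attr_step E V1 W ^^ 0) U \<subseteq> attr_P E V1 W U"
    unfolding attr_P_def by blast
  thus ?thesis by simp
qed

text \<open>The attractor contains the set it grows from, so every vertex that survives a removal
  can reach \<open>B\<close>. This confines all graphs after the first to the reaching set of the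
  first.\<close>

lemma alg_step_subset_reach_set: "alg_step E V1 B W \<subseteq> reach_set E B W"
proof (cases "unreach E B W = {}")
  case True
  thus ?thesis by (auto simp: alg_step_def unreach_def)
next
  case False
  hence "alg_step E V1 B W \<subseteq> W - unreach E B W"
    using subset_attr_P[of "unreach E B W" E V1 W] by (auto simp: alg_step_def)
  thus ?thesis by (auto simp: unreach_def)
qed

lemma alg_step_funpow_subset: "(alg_step E V1 B ^^ k) W \<subseteq> W"
proof (induction k)
  case (Suc k)
  have "alg_step E V1 B ((alg_step E V1 B ^^ k) W) \<subseteq> (alg_step E V1 B ^^ k) W"
    using alg_step_subset_reach_set reach_set_subset by blast
  with Suc show ?case by simp
qed simp

text \<open>A step that does not stop removes at least one vertex, so induction on the cardinality
  applies. This gives the \<open>LEAST\<close> in \<open>num_iterations\<close> a witness.\<close>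

lemma ex_unreach_empty:
  assumes "finite W"
  shows "\<exists>k\<le>card W. unreach E B ((alg_step E V1 B ^^ k) W) = {}"
  using assms
proof (induction W rule: measure_induct_rule[where f = card])
  case (less W)
  show ?case
  proof (cases "unreach E B W = {}")
    case True
    thus ?thesis by (intro exI[of _ 0]) simp
  next
    case False
    let ?W = "alg_step E V1 B W"
    have "?W \<subset> W"
      using False alg_step_subset_reach_set[of E V1 B W] reach_set_subset[of E B W]
      by (auto simp: unreach_def)
    hence c: "card ?W < card W" and f: "finite ?W"
      using less.prems by (auto intro: psubset_card_mono finite_subset)
    obtain k where "k \<le> card ?W" "unreach E B ((alg_step E V1 B ^^ k) ?W) = {}"
      using less.IH[OF c f] by blast
    thus ?thesis using c
      by (intro exI[of _ "Suc k"]) (simp add: funpow_Suc_right del: funpow.simps)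
  qed
qed

lemma num_iterations_le:
  assumes "unreach E B (alg_vertices n E V1 B k) = {}"
  shows "num_iterations n E V1 B \<le> Suc k"
  unfolding num_iterations_def using assms by (simp add: Least_le)

text \<open>For \<open>T < n\<close>, one step leads into the reaching set, at most \<open>T\<close>
  further steps empty the unreachable part, and the stopping iteration is counted too. The
  \<open>if\<close> keeps \<open>T = n\<close> out of the random term, since there a bound linear in
  \<open>T\<close> would be far too large.\<close>

lemma num_iterations_le_card_reach_set:
  fixes n E B
  defines "T \<equiv> card (reach_set E B {..<n})"
  shows "num_iterations n E V1 B \<le> Suc (if T < n then T + 1 else 0)"
proof (cases "T < n")
  case False
  hence "card {..<n} \<le> T" by simp
  hence "reach_set E B {..<n} = {..<n}"
    unfolding T_def by (intro card_seteq) (auto simp: reach_set_subset)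
  hence "unreach E B (alg_vertices n E V1 B 0) = {}"
    by (simp add: unreach_def alg_vertices_def)
  from num_iterations_le[OF this] False show ?thesis by simp
next
  case True
  let ?W = "alg_step E V1 B {..<n}"
  have W: "?W \<subseteq> reach_set E B {..<n}" by (rule alg_step_subset_reach_set)
  have fin: "finite (reach_set E B {..<n})"
    using reach_set_subset finite_lessThan by (rule finite_subset)
  obtain k where k: "k \<le> card ?W" "unreach E B ((alg_step E V1 B ^^ k) ?W) = {}"
    using ex_unreach_empty finite_subset[OF W fin] by blast
  have "unreach E B (alg_vertices n E V1 B (Suc k)) = {}"
    using k(2) by (simp add: alg_vertices_def funpow_Suc_right del: funpow.simps)
  from num_iterations_le[OF this] k(1) card_mono[OF fin W] True show ?thesis
    by (simp add: T_def)
qed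

lemma card_edges_in_le:
  assumes "finite W" and "\<And>u. u \<in> W \<Longrightarrow> finite (E u) \<and> card (E u) \<le> D"
  shows "card (edges_in E W) \<le> D * card W"
proof -
  have "edges_in E W = (SIGMA u:W. E u \<inter> W)"
    by (auto simp: edges_in_def)
  hence "card (edges_in E W) = (\<Sum>u\<in>W. card (E u \<inter> W))"
    using assms by (simp add: card_SigmaI)
  also have "\<dots> \<le> (\<Sum>u\<in>W. D)"
    using assms(2) by (intro sum_mono) (meson card_mono inf_le1 le_trans)
  finally show ?thesis by (simp add: mult.commute)
qed

text \<open>Every current graph has at most \<open>n\<close> vertices and \<open>D * n\<close>
  edges, so the iteration bound is multiplied by \<open>(D + 1) * n\<close>.\<close>

lemma running_time_le:
  fixes n E B
  assumes E: "\<And>u. u < n \<Longrightarrow> finite (E u) \<and> card (E u) \<le> D"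
  defines "T \<equiv> card (reach_set E B {..<n})"
  shows "running_time n E V1 B \<le> (D + 1) * n * Suc (if T < n then T + 1 else 0)"
proof -
  have sub: "alg_vertices n E V1 B k \<subseteq> {..<n}" for k
    unfolding alg_vertices_def by (rule alg_step_funpow_subset)
  have cost: "card (alg_vertices n E V1 B k) + card (edges_in E (alg_vertices n E V1 B k))
                \<le> (D + 1) * n" for k
  proof -
    have "card (edges_in E (alg_vertices n E V1 B k)) \<le> D * card (alg_vertices n E V1 B k)"
      using sub[of k] E by (intro card_edges_in_le) (auto intro: finite_subset)
    also have "card (alg_vertices n E V1 B k) \<le> n"
      using card_mono[OF finite_lessThan sub[of k]] by simp
    finally show ?thesis
      using card_mono[OF finite_lessThan sub[of k]] by simp
  qed
  have "running_time n E V1 B \<le> (\<Sum>k<num_iterations n E V1 B. (D + 1) * n)"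
    unfolding running_time_def by (intro sum_mono cost)
  also have "\<dots> = (D + 1) * n * num_iterations n E V1 B" by simp
  also have "\<dots> \<le> (D + 1) * n * Suc (if T < n then T + 1 else 0)"
    unfolding T_def by (intro mult_left_mono num_iterations_le_card_reach_set) simp
  finally show ?thesis .
qed

section \<open>The random graph\<close>

text \<open>Nonemptiness is the side condition for computing with \<open>pmf_of_set\<close> as a
  uniform distribution.\<close>

lemma ex_subset_of_card:
  assumes "d \<le> n"
  shows "{S. S \<subseteq> {..<n} \<and> card S = d} \<noteq> {}"
proof -
  have "{..<d} \<subseteq> {..<n}" "card {..<d} = d" using assms by auto
  thus ?thesis by blast
qed

lemma set_pmf_random_edges:
  assumes "\<And>v. v < n \<Longrightarrow> d v \<le> n" and "E \<in> set_pmf (random_edges n d)" and "v < n"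
  shows "E v \<subseteq> {..<n}" and "card (E v) = d v"
proof -
  have "E v \<in> set_pmf (pmf_of_set {S. S \<subseteq> {..<n} \<and> card S = d v})"
    using assms(2,3) by (simp add: random_edges_def set_Pi_pmf PiE_dflt_def)
  also have "\<dots> = {S. S \<subseteq> {..<n} \<and> card S = d v}"
    using assms(1,3) by (intro set_pmf_of_set ex_subset_of_card) auto
  finally show "E v \<subseteq> {..<n}" and "card (E v) = d v" by auto
qed

lemma integrable_random_edges:
  fixes h :: "(nat \<Rightarrow> nat set) \<Rightarrow> real"
  assumes "\<And>v. v < n \<Longrightarrow> d v \<le> n"
  shows "integrable (measure_pmf (random_edges n d)) h"
proof (rule integrable_measure_pmf_finite)
  have "finite (set_pmf (pmf_of_set {S. S \<subseteq> {..<n} \<and> card S = d v}))" if "v < n" for v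
    using assms[OF that] by (subst set_pmf_of_set) (auto intro!: ex_subset_of_card simp del: Collect_empty_eq)
  thus "finite (set_pmf (random_edges n d))"
    unfolding random_edges_def set_Pi_pmf[OF finite_lessThan]
    by (intro finite_PiE_dflt) simp_all
qed

section \<open>Probability that the reaching set is a given set\<close>

lemma prob_out_neighbours_disjoint:
  assumes "Z \<subseteq> {..<n}" and "d \<le> n"
  shows "measure_pmf.prob (pmf_of_set {S. S \<subseteq> {..<n} \<and> card S = d}) {S. S \<inter> Z = {}}
           = real ((n - card Z) choose d) / real (n choose d)"
proof -
  have "{S. S \<subseteq> {..<n} \<and> card S = d} \<inter> {S. S \<inter> Z = {}} = {S. S \<subseteq> {..<n} - Z \<and> card S = d}"
    by auto
  moreover have "card {S. S \<subseteq> {..<n} - Z \<and> card S = d} = (n - card Z) choose d"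
    using assms by (subst n_subsets) (auto simp: card_Diff_subset finite_subset)
  moreover have "card {S. S \<subseteq> {..<n} \<and> card S = d} = n choose d"
    by (subst n_subsets) auto
  ultimately show ?thesis
    using ex_subset_of_card[OF assms(2)] by (subst measure_pmf_of_set) auto
qed

text \<open>The ratio is the product of (s-i)/(n-i) over i < d. Each factor is at most s/n, and by
  \<open>2 \<le> d\<close> there are at least two of them.\<close>

lemma binomial_ratio_le:
  assumes "2 \<le> d" "d \<le> n" "s \<le> n"
  shows "real (s choose d) / real (n choose d) \<le> (real s / real n)\<^sup>2"
proof (cases "d \<le> s")
  case False
  thus ?thesis by (simp add: binomial_eq_0)
next
  case True
  \<comment> \<open>Absorption applied twice splits off the first two factors; what remains is a
    ratio of binomials that is at most 1.\<close>
  have expand: "real d * (real d - 1) * real (m choose d)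
                  = real m * (real m - 1) * real ((m - 2) choose (d - 2))"
    if "d \<le> m" for m
  proof -
    have "d * (m choose d) = m * ((m - 1) choose (d - 1))"
      using assms by (intro times_binomial_minus1_eq) auto
    moreover have "(d - 1) * ((m - 1) choose (d - 1)) = (m - 1) * ((m - 2) choose (d - 2))"
      using times_binomial_minus1_eq[of "d - 1" "m - 1"] assms by (simp add: numeral_2_eq_2)
    ultimately have "d * (d - 1) * (m choose d) = m * (m - 1) * ((m - 2) choose (d - 2))"
      by (metis mult.assoc mult.left_commute)
    hence "real d * real (d - 1) * real (m choose d)
             = real m * real (m - 1) * real ((m - 2) choose (d - 2))"
      by (metis of_nat_mult)
    thus ?thesis using assms that by (simp add: of_nat_diff)
  qed
  let ?c = "real d * (real d - 1)"
  let ?x = "real ((s - 2) choose (d - 2))" and ?y = "real ((n - 2) choose (d - 2))"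
  have c: "?c > 0" using assms by simp
  have y: "?y > 0" using assms by simp
  have "?x \<le> ?y" using assms by (intro of_nat_mono binomial_right_mono) auto
  have n: "real n > 1" "real s > 1" "real s \<le> real n" using assms True by auto
  have "real (s choose d) / real (n choose d)
          = (?c * real (s choose d)) / (?c * real (n choose d))"
    using c by (intro mult_divide_mult_cancel_left[symmetric]) linarith
  also have "\<dots> = (real s * (real s - 1) * ?x) / (real n * (real n - 1) * ?y)"
    unfolding expand[OF True] expand[OF assms(2)] ..
  also have "\<dots> = (real s * (real s - 1)) / (real n * (real n - 1)) * (?x / ?y)" by simp
  also have "\<dots> \<le> (real s * (real s - 1)) / (real n * (real n - 1)) * 1"
    using n y \<open>?x \<le> ?y\<close> by (intro mult_left_mono) auto
  also have "\<dots> = real s / real n * ((real s - 1) / (real n - 1))" by simp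
  also have "\<dots> \<le> real s / real n * (real s / real n)"
    using n by (intro mult_left_mono) (auto simp: field_simps)
  finally show ?thesis by (simp add: power2_eq_square)
qed

text \<open>If \<open>Z\<close> is the reaching set, each out-neighbour set satisfies a condition
  that depends on \<open>Z\<close> alone: it meets \<open>Z\<close> for v in \<open>Z - B\<close>
  and avoids \<open>Z\<close> for v outside \<open>Z\<close>. Independence gives the product, with
  \<open>q v\<close> the probability of avoiding \<open>Z\<close>.\<close>

lemma prob_reach_set_eq_le:
  fixes n d Z
  assumes d: "\<And>v. v < n \<Longrightarrow> d v \<le> n" and Z: "B \<subseteq> Z" "Z \<subseteq> {..<n}"
  defines "q \<equiv> \<lambda>v. real ((n - card Z) choose d v) / real (n choose d v)"
  shows "measure_pmf.prob (random_edges n d) {E. reach_set E B {..<n} = Z}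
           \<le> (\<Prod>v\<in>Z - B. 1 - q v) * (\<Prod>v\<in>{..<n} - Z. q v)"
proof -
  let ?p = "\<lambda>v. pmf_of_set {S. S \<subseteq> {..<n} \<and> card S = d v}"
  \<comment> \<open>Vertices of \<open>B\<close> are unconstrained, because the empty path already
    puts them into the reaching set.\<close>
  define A where "A = (\<lambda>v. if v \<in> Z - B then {S. S \<inter> Z \<noteq> {}}
                           else if v \<in> Z then UNIV else {S. S \<inter> Z = {}})"
  have sub: "{E. reach_set E B {..<n} = Z} \<subseteq> Pi {..<n} A"
  proof (intro subsetI Pi_I)
    fix E v assume "E \<in> {E. reach_set E B {..<n} = Z}" and v: "v \<in> {..<n}"
    hence R: "Z = reach_set E B {..<n}" by simp
    have hit: "E v \<inter> reach_set E B {..<n} \<noteq> {}"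
      if "v \<in> reach_set E B {..<n}" "v \<notin> B"
    proof -
      obtain u where u: "u \<in> B" "u < n" "(v, u) \<in> (edges_in E {..<n})\<^sup>*"
        using \<open>v \<in> reach_set E B {..<n}\<close> by (auto simp: reach_set_def)
      then obtain w where "(v, w) \<in> edges_in E {..<n}" "(w, u) \<in> (edges_in E {..<n})\<^sup>*"
        using \<open>v \<notin> B\<close> by (metis converse_rtranclE)
      with u show ?thesis by (auto simp: reach_set_def edges_in_def)
    qed
    have closed: "E v \<inter> reach_set E B {..<n} = {}" if "v \<notin> reach_set E B {..<n}"
    proof (rule ccontr)
      assume "E v \<inter> reach_set E B {..<n} \<noteq> {}"
      then obtain w u where "w \<in> E v" "w < n" "u \<in> B" "u < n" "(w, u) \<in> (edges_in E {..<n})\<^sup>*"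
        by (auto simp: reach_set_def)
      moreover from this v have "(v, w) \<in> edges_in E {..<n}" by (auto simp: edges_in_def)
      ultimately have "v \<in> reach_set E B {..<n}"
        using v by (auto simp: reach_set_def intro: converse_rtrancl_into_rtrancl)
      with that show False by simp
    qed
    show "E v \<in> A v" using hit closed unfolding A_def R by auto
  qed
  have pA: "measure_pmf.prob (?p v) (A v) = (if v \<in> Z - B then 1 - q v else if v \<in> Z then 1 else q v)"
    if "v < n" for v
  proof -
    have q: "measure_pmf.prob (?p v) {S. S \<inter> Z = {}} = q v"
      unfolding q_def by (rule prob_out_neighbours_disjoint[OF Z(2) d[OF that]])
    have "{S. S \<inter> Z \<noteq> {}} = UNIV - {S. S \<inter> Z = {}}" by auto
    hence "measure_pmf.prob (?p v) {S. S \<inter> Z \<noteq> {}} = 1 - q v"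
      using measure_pmf.prob_compl[of "{S. S \<inter> Z = {}}" "?p v"] q by simp
    with q show ?thesis by (simp add: A_def)
  qed
  have "measure_pmf.prob (random_edges n d) {E. reach_set E B {..<n} = Z}
          \<le> measure_pmf.prob (random_edges n d) (Pi {..<n} A)"
    using sub by (intro measure_pmf.finite_measure_mono) auto
  also have "\<dots> = (\<Prod>v<n. measure_pmf.prob (?p v) (A v))"
    unfolding random_edges_def by (rule measure_Pi_pmf_Pi) simp
  also have "\<dots> = (\<Prod>v<n. if v \<in> Z - B then 1 - q v else if v \<in> Z then 1 else q v)"
    by (intro prod.cong) (simp_all add: pA)
  also have "\<dots> = (\<Prod>v\<in>{..<n} - Z. if v \<in> Z - B then 1 - q v else if v \<in> Z then 1 else q v)
                 * (\<Prod>v\<in>Z. if v \<in> Z - B then 1 - q v else if v \<in> Z then 1 else q v)"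
    by (rule prod.subset_diff[OF Z(2)]) simp
  also have "(\<Prod>v\<in>{..<n} - Z. if v \<in> Z - B then 1 - q v else if v \<in> Z then 1 else q v)
               = (\<Prod>v\<in>{..<n} - Z. q v)"
    by (intro prod.cong) auto
  also have "(\<Prod>v\<in>Z. if v \<in> Z - B then 1 - q v else if v \<in> Z then 1 else q v)
               = (\<Prod>v\<in>Z - B. 1 - q v)"
    using Z by (intro prod.mono_neutral_cong_right) (auto intro: finite_subset)
  finally show ?thesis by (simp add: mult.commute)
qed

text \<open>Union bound over the possible reaching sets, all of which contain
  \<open>B\<close>.\<close>

lemma prob_card_reach_set_eq_le:
  fixes t :: nat
  assumes "B \<subseteq> {..<n}"
  shows "measure_pmf.prob (random_edges n d) {E. card (reach_set E B {..<n}) = t}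
           \<le> (\<Sum>Z | B \<subseteq> Z \<and> Z \<subseteq> {..<n} \<and> card Z = t.
                 measure_pmf.prob (random_edges n d) {E. reach_set E B {..<n} = Z})"
proof -
  let ?F = "{Z. B \<subseteq> Z \<and> Z \<subseteq> {..<n} \<and> card Z = t}"
  have "B \<subseteq> reach_set E B {..<n}" for E
    using assms by (auto simp: reach_set_def)
  hence "{E. card (reach_set E B {..<n}) = t} = (\<Union>Z\<in>?F. {E. reach_set E B {..<n} = Z})"
    using reach_set_subset by auto
  moreover have "finite ?F"
    by (rule finite_subset[of _ "Pow {..<n}"]) auto
  ultimately show ?thesis
    using measure_pmf.finite_measure_subadditive_finite[of ?F
        "\<lambda>Z. {E. reach_set E B {..<n} = Z}" "random_edges n d"] by simp
qed

section \<open>The size of the reaching set\<close>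

text \<open>Chernoff method with weight 4/5 per element. Up to the weight, the sum over
  \<open>Z\<close> is part of the expansion of a product of factors 4/5 * (1 - q v) + q v, each at
  most exp(-\<tau>/4).\<close>

lemma prob_card_reach_set_small:
  fixes t :: nat
  assumes d: "\<And>v. v < n \<Longrightarrow> 2 \<le> d v \<and> d v \<le> n" and B: "B \<subseteq> {..<n}"
    and t: "4 * t \<le> 3 * n" and n: "n > 0"
  shows "measure_pmf.prob (random_edges n d) {E. card (reach_set E B {..<n}) = t}
           \<le> (5/4 * exp (- 1/4)) ^ t"
proof -
  let ?P = "\<lambda>X. measure_pmf.prob (random_edges n d) X"
  let ?F = "{Z. B \<subseteq> Z \<and> Z \<subseteq> {..<n} \<and> card Z = t}"
  define q where "q = (\<lambda>v. real ((n - t) choose d v) / real (n choose d v))"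
  define \<tau> where "\<tau> = real t / real n"
  define b where "b = card B"
  have \<tau>: "0 \<le> \<tau>" "\<tau> \<le> 3/4" "real n * \<tau> = real t"
    using t n by (auto simp: \<tau>_def field_simps)
  have q01: "0 \<le> q v" "q v \<le> 1 - 5/4 * \<tau>" if "v < n" for v
  proof -
    have "q v \<le> (real (n - t) / real n)\<^sup>2"
      unfolding q_def using d[OF that] by (intro binomial_ratio_le) auto
    also have "real (n - t) / real n = 1 - \<tau>"
      using t n by (simp add: \<tau>_def of_nat_diff field_simps)
    \<comment> \<open>The quadratic is replaced by its chord over [0, 3/4], which is where the
      restriction on \<open>t\<close> enters.\<close>
    also have "(1 - \<tau>)\<^sup>2 = 1 - 5/4 * \<tau> - \<tau> * (3/4 - \<tau>)"
      by (simp add: power2_eq_square algebra_simps)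
    also have "\<dots> \<le> 1 - 5/4 * \<tau>" using \<tau> by simp
    finally show "q v \<le> 1 - 5/4 * \<tau>" .
  qed (simp add: q_def)
  have q1: "q v \<le> 1" if "v < n" for v
    using q01(2)[OF that] \<tau>(1) by linarith
  have finB: "finite B" using B finite_subset by blast
  show ?thesis
  proof (cases "b \<le> t")
    case False
    have "?F = {}"
    proof -
      have "b \<le> card Z" if "B \<subseteq> Z" "Z \<subseteq> {..<n}" for Z
        unfolding b_def using that by (intro card_mono) (auto intro: finite_subset)
      thus ?thesis using False by auto
    qed
    moreover have "(0::real) \<le> (5/4 * exp (- 1/4)) ^ t" by simp
    ultimately show ?thesis
      using prob_card_reach_set_eq_le[OF B, of d t] by (smt (verit) sum.empty)
  next
    case True
    have "(4/5) ^ (t - b) * ?P {E. card (reach_set E B {..<n}) = t}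
            \<le> (4/5) ^ (t - b) * (\<Sum>Z\<in>?F. ?P {E. reach_set E B {..<n} = Z})"
      by (intro mult_left_mono prob_card_reach_set_eq_le[OF B]) simp
    also have "\<dots> \<le> (4/5) ^ (t - b) * (\<Sum>Z\<in>?F. (\<Prod>v\<in>Z - B. 1 - q v) * (\<Prod>v\<in>{..<n} - Z. q v))"
    proof (intro mult_left_mono sum_mono)
      fix Z assume "Z \<in> ?F"
      thus "?P {E. reach_set E B {..<n} = Z} \<le> (\<Prod>v\<in>Z - B. 1 - q v) * (\<Prod>v\<in>{..<n} - Z. q v)"
        using prob_reach_set_eq_le[of n d B Z] d by (auto simp: q_def)
    qed simp
    \<comment> \<open>The weight is spread over the \<open>t - b\<close> elements of
      \<open>Z - B\<close>.\<close>
    also have "\<dots> = (\<Sum>Z\<in>?F. (\<Prod>v\<in>Z - B. 4/5 * (1 - q v)) * (\<Prod>v\<in>({..<n} - B) - (Z - B). q v))"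
      unfolding sum_distrib_left
    proof (intro sum.cong refl)
      fix Z assume Z: "Z \<in> ?F"
      hence "card (Z - B) = t - b" using finB by (simp add: card_Diff_subset b_def)
      moreover have "({..<n} - B) - (Z - B) = {..<n} - Z" using Z by auto
      ultimately show "(4/5) ^ (t - b) * ((\<Prod>v\<in>Z - B. 1 - q v) * (\<Prod>v\<in>{..<n} - Z. q v))
          = (\<Prod>v\<in>Z - B. 4/5 * (1 - q v)) * (\<Prod>v\<in>({..<n} - B) - (Z - B). q v)"
        by (simp only: prod.distrib prod_constant mult.assoc)
    qed
    also have "\<dots> = (\<Sum>X\<in>(\<lambda>Z. Z - B) ` ?F. (\<Prod>v\<in>X. 4/5 * (1 - q v)) * (\<Prod>v\<in>({..<n} - B) - X. q v))"
      by (subst sum.reindex) (auto simp: inj_on_def)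
    \<comment> \<open>Dropping the cardinality condition completes the sum to the full expansion of
      a product over the complement of \<open>B\<close>.\<close>
    also have "\<dots> \<le> (\<Sum>X\<in>Pow ({..<n} - B). (\<Prod>v\<in>X. 4/5 * (1 - q v)) * (\<Prod>v\<in>({..<n} - B) - X. q v))"
    proof (intro sum_mono2)
      fix X assume "X \<in> Pow ({..<n} - B) - (\<lambda>Z. Z - B) ` ?F"
      hence "\<And>v. v \<in> X \<Longrightarrow> v < n" by auto
      thus "0 \<le> (\<Prod>v\<in>X. 4/5 * (1 - q v)) * (\<Prod>v\<in>({..<n} - B) - X. q v)"
        using q01(1) q1 by (intro mult_nonneg_nonneg prod_nonneg) simp_all
    qed auto
    also have "\<dots> = (\<Prod>v\<in>{..<n} - B. 4/5 * (1 - q v) + q v)"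
      by (rule prod_add[symmetric]) simp
    \<comment> \<open>Each factor equals 4/5 + q v / 5, hence is at most 1 - \<tau>/4.\<close>
    also have "\<dots> \<le> (\<Prod>v\<in>{..<n} - B. exp (- \<tau> / 4))"
    proof (intro prod_mono conjI)
      fix v assume "v \<in> {..<n} - B"
      hence v: "0 \<le> q v" "q v \<le> 1 - 5/4 * \<tau>" using q01 by auto
      have "1 + (- \<tau> / 4) \<le> exp (- \<tau> / 4)" by (rule exp_ge_add_one_self)
      with v show "4/5 * (1 - q v) + q v \<le> exp (- \<tau> / 4)" by argo
      show "0 \<le> 4/5 * (1 - q v) + q v" using v by argo
    qed
    also have "\<dots> = exp (- \<tau> / 4) ^ (n - b)"
      using B finB by (simp add: card_Diff_subset b_def)
    finally have main: "(4/5) ^ (t - b) * ?P {E. card (reach_set E B {..<n}) = t}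
                          \<le> exp (- \<tau> / 4) ^ (n - b)" .
    have bn: "b \<le> n" using card_mono[OF finite_lessThan B] by (simp add: b_def)
    \<comment> \<open>This supplies the factors missing for \<open>B\<close>: multiplying by (4/5)^b
      on the left and by exp(-\<tau>/4)^b on the right turns the exponents \<open>t - b\<close> and
      \<open>n - b\<close> into \<open>t\<close> and \<open>n\<close>.\<close>
    have "4/5 \<le> 1 + (- \<tau> / 4)" using \<tau> by simp
    also have "\<dots> \<le> exp (- \<tau> / 4)" by (rule exp_ge_add_one_self)
    finally have e: "(4/5) ^ b \<le> exp (- \<tau> / 4) ^ b" by (intro power_mono) auto
    have "(4/5) ^ t * ?P {E. card (reach_set E B {..<n}) = t}
            = (4/5) ^ b * ((4/5) ^ (t - b) * ?P {E. card (reach_set E B {..<n}) = t})"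
      using True by (simp only: mult.assoc[symmetric] power_add[symmetric] le_add_diff_inverse)
    also have "\<dots> \<le> exp (- \<tau> / 4) ^ b * exp (- \<tau> / 4) ^ (n - b)"
      using e main by (intro mult_mono) auto
    also have "\<dots> = exp (- \<tau> / 4) ^ n"
      using bn by (simp only: power_add[symmetric] le_add_diff_inverse)
    also have "\<dots> = exp (real n * (- \<tau> / 4))" by (rule exp_of_nat_mult[symmetric])
    also have "real n * (- \<tau> / 4) = real t * (- 1/4)" using \<tau>(3) by simp
    also have "exp (real t * (- 1/4)) = exp (- 1/4) ^ t" by (rule exp_of_nat_mult)
    finally have "(5/4) ^ t * ((4/5) ^ t * ?P {E. card (reach_set E B {..<n}) = t})
                    \<le> (5/4) ^ t * exp (- 1/4) ^ t"
      by (intro mult_left_mono) auto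
    thus ?thesis by (simp add: mult.assoc[symmetric] power_mult_distrib[symmetric])
  qed
qed

text \<open>The quotient of \<open>s ^ s\<close> by \<open>fact s\<close> is a single term of the
  exponential series at s, so it is at most e^s: a weak form of Stirling's bound.\<close>

lemma self_power_le_fact: "real s ^ s \<le> 3 ^ s * fact s"
proof -
  have "real s ^ s / fact s \<le> exp (real s)"
  proof -
    have "(\<Sum>k\<in>{s}. real s ^ k /\<^sub>R fact k) \<le> (\<Sum>k. real s ^ k /\<^sub>R fact k)"
      by (intro sum_le_suminf summable_exp_generic) auto
    thus ?thesis by (simp add: exp_def divide_inverse mult.commute)
  qed
  also have "exp (real s) = exp 1 ^ s" using exp_of_nat_mult[of s 1] by simp
  also have "\<dots> \<le> 3 ^ s" using exp_le by (intro power_mono) auto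
  finally show ?thesis by (simp add: field_simps)
qed

text \<open>Only the \<open>s\<close> vertices outside \<open>Z\<close> are used: each avoids
  \<open>Z\<close> with probability at most (s/n)^2, and there are at most \<open>n choose s\<close>
  choices of \<open>Z\<close>.\<close>

lemma prob_card_reach_set_large:
  fixes s :: nat
  assumes d: "\<And>v. v < n \<Longrightarrow> 2 \<le> d v \<and> d v \<le> n" and B: "B \<subseteq> {..<n}"
    and s: "0 < s" "4 * s \<le> n"
  shows "measure_pmf.prob (random_edges n d) {E. card (reach_set E B {..<n}) = n - s}
           \<le> 3 / real n * (real s * (3/4) ^ (s - 1))"
proof -
  let ?P = "\<lambda>X. measure_pmf.prob (random_edges n d) X"
  let ?F = "{Z. B \<subseteq> Z \<and> Z \<subseteq> {..<n} \<and> card Z = n - s}"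
  define q where "q = (\<lambda>v. real (s choose d v) / real (n choose d v))"
  have n: "real n > 0" using s by simp
  have q01: "0 \<le> q v" "q v \<le> (real s / real n)\<^sup>2" "q v \<le> 1" if "v < n" for v
  proof -
    show "q v \<le> (real s / real n)\<^sup>2"
      unfolding q_def using d[OF that] s by (intro binomial_ratio_le) auto
    also have "\<dots> \<le> 1" using s n by (intro power_le_one) auto
    finally show "q v \<le> 1" .
  qed (simp add: q_def)
  have "?P {E. card (reach_set E B {..<n}) = n - s} \<le> (\<Sum>Z\<in>?F. ?P {E. reach_set E B {..<n} = Z})"
    by (rule prob_card_reach_set_eq_le[OF B])
  also have "\<dots> \<le> (\<Sum>Z\<in>?F. (real s / real n) ^ (2 * s))"
  proof (intro sum_mono)
    fix Z assume Z: "Z \<in> ?F"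
    have fZ: "finite Z" using Z finite_subset by blast
    have ns: "n - card Z = s" using Z s by auto
    have "?P {E. reach_set E B {..<n} = Z} \<le> (\<Prod>v\<in>Z - B. 1 - q v) * (\<Prod>v\<in>{..<n} - Z. q v)"
      using prob_reach_set_eq_le[of n d B Z] d Z ns by (auto simp: q_def)
    also have "\<dots> \<le> 1 * (\<Prod>v\<in>{..<n} - Z. (real s / real n)\<^sup>2)"
    proof (intro mult_mono prod_mono)
      have "v < n" if "v \<in> Z" for v using that Z by auto
      thus "(\<Prod>v\<in>Z - B. 1 - q v) \<le> 1"
        using q01 by (intro prod_le_1) auto
    qed (use q01 in \<open>auto intro!: prod_nonneg\<close>)
    also have "\<dots> = (real s / real n) ^ (2 * s)"
      using Z fZ ns by (simp add: card_Diff_subset power_mult)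
    finally show "?P {E. reach_set E B {..<n} = Z} \<le> (real s / real n) ^ (2 * s)" .
  qed
  also have "\<dots> \<le> real (n choose s) * (real s / real n) ^ (2 * s)"
  proof -
    have "?F \<subseteq> {Z. Z \<subseteq> {..<n} \<and> card Z = n - s}" by auto
    hence "card ?F \<le> card {Z. Z \<subseteq> {..<n} \<and> card Z = n - s}"
      by (intro card_mono) auto
    also have "\<dots> = n choose s"
      using s by (subst n_subsets) (auto intro: binomial_symmetric[symmetric])
    finally show ?thesis by (simp add: mult_right_mono)
  qed
  also have "\<dots> \<le> (real n ^ s / fact s) * (real s / real n) ^ (2 * s)"
  proof (intro mult_right_mono)
    have "real ((n choose s) * fact s) \<le> real (n ^ s)"
      using binomial_fact_pow by (rule of_nat_mono)
    thus "real (n choose s) \<le> real n ^ s / fact s" by (simp add: field_simps)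
  qed simp
  also have "\<dots> = (real s ^ s / fact s) * (real s / real n) ^ s"
  proof -
    have "real n ^ s * (real s / real n) ^ s = real s ^ s"
      using n by (simp add: power_mult_distrib[symmetric])
    thus ?thesis by (simp only: mult_2 power_add) (simp only: mult.assoc[symmetric] times_divide_eq_left)
  qed
  also have "\<dots> \<le> 3 ^ s * (real s / real n) ^ s"
    using self_power_le_fact[of s] by (intro mult_right_mono) (auto simp: field_simps)
  also have "\<dots> = (3 * real s / real n) ^ s"
    by (simp add: power_mult_distrib power_divide)
  \<comment> \<open>One factor is kept for its 1/n; the others are at most 3/4 because
    \<open>4 * s \<le> n\<close>.\<close>
  also have "\<dots> = (3 * real s / real n) * (3 * real s / real n) ^ (s - 1)"
    using s by (simp add: power_eq_if)
  also have "\<dots> \<le> (3 * real s / real n) * (3/4) ^ (s - 1)"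
    using s n by (intro mult_left_mono power_mono) (auto simp: field_simps)
  finally show ?thesis by (simp add: mult.assoc)
qed

text \<open>The first summand is the series of (t+1) \<rho>^t with \<rho> = 5/4 * exp(-1/4); the
  second is three times the same series at 3/4, whose value is 16.\<close>

definition reach_bound :: real where
  "reach_bound = 1 / (1 - 5/4 * exp (- 1/4))\<^sup>2 + 48"

lemma expectation_card_reach_set_le:
  assumes d: "\<And>v. v < n \<Longrightarrow> 2 \<le> d v \<and> d v \<le> n" and B: "B \<subseteq> {..<n}" and n: "n > 0"
  shows "measure_pmf.expectation (random_edges n d)
           (\<lambda>E. if card (reach_set E B {..<n}) < n then real (card (reach_set E B {..<n})) + 1 else 0)
         \<le> reach_bound"
proof -
  let ?M = "random_edges n d"
  let ?T = "\<lambda>E. card (reach_set E B {..<n})"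
  let ?p = "\<lambda>t. measure_pmf.prob ?M {E. ?T E = t}"
  define \<rho> :: real where "\<rho> = 5/4 * exp (- 1/4)"
  \<comment> \<open>This strict inequality is exactly \<rho> < 1.\<close>
  have "1 + 1/4 < exp (1/4 :: real)" using exp_minus_greater[of "- 1/4"] by simp
  hence \<rho>: "0 \<le> \<rho>" "\<rho> < 1" by (auto simp: \<rho>_def exp_minus field_simps)
  define f where "f = (\<lambda>t. real (Suc t) * \<rho> ^ t)"
  define g where "g = (\<lambda>t. real (Suc t) * (3/4 :: real) ^ t)"
  have f: "f sums (1 / (1 - \<rho>)\<^sup>2)" unfolding f_def
    using \<rho> geometric_deriv_sums[of \<rho>] by simp
  have g: "g sums 16" unfolding g_def
    using geometric_deriv_sums[of "3/4 :: real"] by (simp add: power2_eq_square)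
  have f0: "0 \<le> f t" and g0: "0 \<le> g t" for t using \<rho> by (auto simp: f_def g_def)
  \<comment> \<open>Each summand on the right handles one range of \<open>t\<close>. In the upper
    range \<open>t + 1 \<le> n\<close> cancels the factor 1/n, and \<open>g\<close> is evaluated at
    s - 1 for s = n - t.\<close>
  have p: "(real t + 1) * ?p t \<le> f t + 3 * g (n - 1 - t)" if t: "t < n" for t
  proof (cases "4 * t \<le> 3 * n")
    case True
    have "?p t \<le> \<rho> ^ t"
      unfolding \<rho>_def by (rule prob_card_reach_set_small[OF d B True n])
    hence "(real t + 1) * ?p t \<le> f t"
      unfolding f_def of_nat_Suc add.commute[of 1] by (intro mult_left_mono) auto
    with g0[of "n - 1 - t"] show ?thesis by simp
  next
    case False
    let ?s = "n - t"
    have "?p (n - ?s) \<le> 3 / real n * (real ?s * (3/4) ^ (?s - 1))"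
      using False t by (intro prob_card_reach_set_large[OF d B]) auto
    moreover have "real ?s * (3/4) ^ (?s - 1) = g (n - 1 - t)"
      using t by (simp add: g_def)
    ultimately have "?p t \<le> 3 / real n * g (n - 1 - t)" using t by simp
    hence "(real t + 1) * ?p t \<le> real n * (3 / real n * g (n - 1 - t))"
      using t g0 by (intro mult_mono) auto
    with f0[of t] n show ?thesis by simp
  qed
  have fin: "integrable (measure_pmf ?M) h" for h :: "_ \<Rightarrow> real"
    using d by (intro integrable_random_edges) auto
  have "(if ?T E < n then real (?T E) + 1 else 0)
          = (\<Sum>t<n. (real t + 1) * indicator {E. ?T E = t} E)" for E
  proof -
    have "(\<Sum>t<n. (real t + 1) * indicator {E. ?T E = t} E)
            = (\<Sum>t<n. if t = ?T E then real t + 1 else 0)"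
      by (intro sum.cong) auto
    thus ?thesis by simp
  qed
  hence "measure_pmf.expectation ?M (\<lambda>E. if ?T E < n then real (?T E) + 1 else 0)
           = measure_pmf.expectation ?M (\<lambda>E. \<Sum>t<n. (real t + 1) * indicator {E. ?T E = t} E)"
    by (simp only:)
  also have "\<dots> = (\<Sum>t<n. (real t + 1) * ?p t)"
    by (subst Bochner_Integration.integral_sum) (auto intro: fin)
  also have "\<dots> \<le> (\<Sum>t<n. f t + 3 * g (n - 1 - t))"
    using p by (intro sum_mono) auto
  \<comment> \<open>Reversing the order of summation makes the second sum a partial sum of
    \<open>g\<close>.\<close>
  also have "\<dots> = (\<Sum>t<n. f t) + 3 * (\<Sum>t<n. g t)"
    using sum.nat_diff_reindex[of g n] by (simp add: sum.distrib sum_distrib_left[symmetric])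
  also have "\<dots> \<le> 1 / (1 - \<rho>)\<^sup>2 + 3 * 16"
    using sum_le_suminf[OF sums_summable[OF f], of "{..<n}"] f0
      sum_le_suminf[OF sums_summable[OF g], of "{..<n}"] g0
    by (simp add: sums_unique[OF f, symmetric] sums_unique[OF g, symmetric])
  finally show ?thesis by (simp add: reach_bound_def \<rho>_def)
qed

section \<open>Expected number of iterations and expected running time\<close>

theorem theorem1:
  fixes dmin dmax :: nat
  assumes "2 \<le> dmin" and "dmin \<le> dmax"
  shows "\<exists>C::real. C > 0 \<and> (\<exists>N::nat. \<forall>n \<ge> N. \<forall>V1 B :: nat set. \<forall>d :: nat \<Rightarrow> nat.
           V1 \<subseteq> {..<n} \<longrightarrow> B \<subseteq> {..<n} \<longrightarrow> (\<forall>v < n. dmin \<le> d v \<and> d v \<le> dmax) \<longrightarrow>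
             measure_pmf.expectation (random_edges n d) (\<lambda>E. real (num_iterations n E V1 B))
               \<le> C * ln (real n)
           \<and> measure_pmf.expectation (random_edges n d) (\<lambda>E. real (running_time n E V1 B))
               \<le> C * real n)"
proof -
  \<comment> \<open>\<open>K\<close> bounds the expected iteration count, and
    \<open>dmax + 1\<close> is the cost per vertex of one iteration.\<close>
  define K where "K = 1 + reach_bound"
  define C where "C = (real dmax + 1) * K"
  have K: "K \<ge> 1" by (simp add: K_def reach_bound_def)
  have KC: "K \<le> C" using K by (simp add: C_def)
  have main: "measure_pmf.expectation (random_edges n d) (\<lambda>E. real (num_iterations n E V1 B))
                \<le> C * ln (real n)
            \<and> measure_pmf.expectation (random_edges n d) (\<lambda>E. real (running_time n E V1 B))
                \<le> C * real n"
    \<comment> \<open>From \<open>n \<ge> 3\<close> follows ln n \<ge> 1, which absorbs the constant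
      bound into \<open>C * ln (real n)\<close>; \<open>n \<ge> dmax\<close> makes every prescribed
      out-degree realizable.\<close>
    if n: "n \<ge> max 3 dmax" and B: "B \<subseteq> {..<n}" and d: "\<forall>v<n. dmin \<le> d v \<and> d v \<le> dmax"
    for n V1 B d
  proof -
    let ?M = "random_edges n d"
    let ?T = "\<lambda>E. card (reach_set E B {..<n})"
    let ?h = "\<lambda>E. if ?T E < n then real (?T E) + 1 else 0"
    have dn: "d v \<le> n" if "v < n" for v
      using d that n by (meson le_trans max.boundedE)
    have fin: "integrable (measure_pmf ?M) h" for h :: "_ \<Rightarrow> real"
      by (rule integrable_random_edges[OF dn])
    have "measure_pmf.expectation ?M ?h \<le> reach_bound"
      using n d assms by (intro expectation_card_reach_set_le[OF _ B]) force+
    hence h: "measure_pmf.expectation ?M (\<lambda>E. 1 + ?h E) \<le> K"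
      using fin by (simp add: K_def)
    have "measure_pmf.expectation ?M (\<lambda>E. real (num_iterations n E V1 B))
            \<le> measure_pmf.expectation ?M (\<lambda>E. 1 + ?h E)"
    proof (intro integral_mono fin)
      fix E
      have "real (num_iterations n E V1 B) \<le> real (Suc (if ?T E < n then ?T E + 1 else 0))"
        by (intro of_nat_mono num_iterations_le_card_reach_set)
      thus "real (num_iterations n E V1 B) \<le> 1 + ?h E" by (simp split: if_splits)
    qed
    also have "\<dots> \<le> C * 1" using h KC by simp
    also have "\<dots> \<le> C * ln (real n)"
    proof (intro mult_left_mono)
      have "exp 1 \<le> real n" using exp_le n by simp
      thus "1 \<le> ln (real n)" using n by (simp add: ln_ge_iff)
    qed (use K KC in simp)
    finally have iter: "measure_pmf.expectation ?M (\<lambda>E. real (num_iterations n E V1 B))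
                          \<le> C * ln (real n)" .
    have "measure_pmf.expectation ?M (\<lambda>E. real (running_time n E V1 B))
            \<le> measure_pmf.expectation ?M (\<lambda>E. (real dmax + 1) * real n * (1 + ?h E))"
    \<comment> \<open>The degree bound on \<open>E\<close> is known only on the support of the
      distribution, so the comparison is made almost everywhere.\<close>
    proof (intro integral_mono_AE fin AE_pmfI)
      fix E assume "E \<in> set_pmf ?M"
      note E = set_pmf_random_edges[OF dn this]
      have "running_time n E V1 B \<le> (dmax + 1) * n * Suc (if ?T E < n then ?T E + 1 else 0)"
        using E d by (intro running_time_le) (auto intro: finite_subset[OF _ finite_lessThan])
      hence "real (running_time n E V1 B)
               \<le> real ((dmax + 1) * n * Suc (if ?T E < n then ?T E + 1 else 0))"
        by (rule of_nat_mono)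
      also have "\<dots> = (real dmax + 1) * real n * (1 + ?h E)"
        by (simp only: of_nat_mult of_nat_add of_nat_Suc of_nat_1) (simp add: algebra_simps)
      finally show "real (running_time n E V1 B) \<le> (real dmax + 1) * real n * (1 + ?h E)" .
    qed
    also have "\<dots> = (real dmax + 1) * real n * measure_pmf.expectation ?M (\<lambda>E. 1 + ?h E)"
      by simp
    also have "\<dots> \<le> (real dmax + 1) * real n * K"
      using h by (intro mult_left_mono) auto
    also have "\<dots> = C * real n" by (simp add: C_def)
    finally show ?thesis using iter by blast
  qed
  show ?thesis
    using main K KC by (intro exI[of _ C] conjI exI[of _ "max 3 dmax"]) auto
qed

end
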